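(* Let $p$ be a prime, $\ell\ge 1$, $R=\mathbb{Z}/p^\ell\mathbb{Z}$, $G$ a finite group, and let $\mathcal{C}\leq RG$ be a relative projective group code with corresponding chain $\mathcal{C}_\star: C_0\leq\dots\leq C_{\ell-1}$. If there exists a $\gamma>0$ with $$d_E(C_j)\geq\frac{\gamma}{p^{2j}}\quad\text{for every } j=0,\dots,\ell-1,$$ then $d_E(\mathcal{C})\geq\gamma$.
   Context: Here $R=\mathbb{Z}/p^\ell\mathbb{Z}$ is a chain ring with maximal ideal $\mathfrak{m}=\pi R$ generated by $\pi=p$, residue field $\mathbb{F}=\mathbb{F}_p=\mathbb{Z}/p\mathbb{Z}$, and length $\ell$. $RG$ and $\mathbb{F}G$ are the group rings. For $j=0,\dots,\ell-1$ let $\alpha_j:\mathfrak{m}^jRG/\mathfrak{m}^{j+1}RG\to\mathbb{F}G$ be the $R$-module isomorphism given coefficientwise by $\pi^jr+\mathfrak{m}^{j+1}\mapsto r+\mathfrak{m}$. A group code over $R$ (resp. $\mathbb{F}$) is a left ideal in $RG$ (resp. $\mathbb{F}G$). A group code $\mathcal{C}\leq RG$ is called relative projective if it is relative projective for the subgroup $\{1\}$ of $G$, i.e. for any short exact sequence $0\to\mathcal{M}\to\mathcal{N}\xrightarrow{\varphi}\mathcal{C}\to 0$ of (left) $RG$-modules for which there is an $R$-module homomorphism $\psi:\mathcal{C}\to\mathcal{N}$ with $\varphi\circ\psi=\mathrm{id}_{\mathcal{C}}$, there is an $RG$-module homomorphism $\psi':\mathcal{C}\to\mathcal{N}$ with $\varphi\circ\psi'=\mathrm{id}_{\mathcal{C}}$.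 The chain $\mathcal{C}_\star$ corresponding to $\mathcal{C}$ consists of the codes $$C_j:=\alpha_j\left(\frac{\mathcal{C}\cap\mathfrak{m}^jRG}{\mathcal{C}\cap\mathfrak{m}^{j+1}RG}\right)\leq\mathbb{F}G,\qquad 0\le j\le\ell-1,$$ where the quotient is regarded as a submodule of $\mathfrak{m}^jRG/\mathfrak{m}^{j+1}RG$. The euclidean weight of $c=\sum_{g\in G}c_gg\in(\mathbb{Z}/p^\ell\mathbb{Z})G$ is $$w_E(c)=\min\left\{\sum_{g\in G}a_g^2\;\middle|\; a_g\in\mathbb{Z},\ a_g+p^\ell\mathbb{Z}=c_g\right\},$$ and the euclidean minimum weight of a code is $d_E(\mathcal{C})=\min\{w_E(c)\mid 0\neq c\in\mathcal{C}\}$. For codes over $\mathbb{F}_p=\mathbb{Z}/p\mathbb{Z}$ these are the same definitions with $\ell$ replaced by $1$. The minimum over the empty set (zero code) is read as $+\infty$. *)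

theory Defs
  imports "HOL-Number_Theory.Residues" "HOL-Library.Extended_Real"
begin

section \<open>Group rings and left modules\<close>

text \<open>Finite groups only: for these all functions on the group have finite support, and the
  sum in the convolution product is finite.\<close>

definition group_ring :: "('a, 'r) ring_scheme \<Rightarrow> ('g, 'x) monoid_scheme \<Rightarrow> ('g \<Rightarrow> 'a) ring" where
  "group_ring R G = \<lparr>
     carrier = carrier G \<rightarrow>\<^sub>E carrier R,
     monoid.mult = (\<lambda>a b. \<lambda>x\<in>carrier G. \<Oplus>\<^bsub>R\<^esub>y\<in>carrier G. a y \<otimes>\<^bsub>R\<^esub> b (inv\<^bsub>G\<^esub> y \<otimes>\<^bsub>G\<^esub> x)),
     one = (\<lambda>x\<in>carrier G. if x = \<one>\<^bsub>G\<^esub> then \<one>\<^bsub>R\<^esub> else \<zero>\<^bsub>R\<^esub>),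
     zero = (\<lambda>x\<in>carrier G. \<zero>\<^bsub>R\<^esub>),
     add = (\<lambda>a b. \<lambda>x\<in>carrier G. a x \<oplus>\<^bsub>R\<^esub> b x)\<rparr>"

text \<open>The embedding \<open>r \<mapsto> r \<cdot> 1\<close> of \<open>R\<close>, by which \<open>R\<close> acts on modules over the group ring.\<close>

definition gr_const :: "('a, 'r) ring_scheme \<Rightarrow> ('g, 'x) monoid_scheme \<Rightarrow> 'a \<Rightarrow> 'g \<Rightarrow> 'a" where
  "gr_const R G r = (\<lambda>x\<in>carrier G. if x = \<one>\<^bsub>G\<^esub> then r else \<zero>\<^bsub>R\<^esub>)"

definition left_ideal :: "'b set \<Rightarrow> ('b, 's) ring_scheme \<Rightarrow> bool" where
  "left_ideal I S \<longleftrightarrow>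
     additive_subgroup I S \<and> (\<forall>a\<in>carrier S. \<forall>x\<in>I. a \<otimes>\<^bsub>S\<^esub> x \<in> I)"

text \<open>The library locale \<open>module\<close> requires a commutative ring of scalars; its axioms are
  repeated here for left modules over an arbitrary ring. As there, the fields \<open>mult\<close> and
  \<open>one\<close> of the record \<open>M\<close> play no role.\<close>

locale left_module = R?: ring R + M?: abelian_group M
  for R :: "('a, 'r) ring_scheme" (structure) and M :: "('a, 'b, 'm) module_scheme" (structure) +
  assumes smult_closed [simp, intro]:
      "\<lbrakk>a \<in> carrier R; x \<in> carrier M\<rbrakk> \<Longrightarrow> a \<odot>\<^bsub>M\<^esub> x \<in> carrier M"
    and smult_l_distr:
      "\<lbrakk>a \<in> carrier R; b \<in> carrier R; x \<in> carrier M\<rbrakk> \<Longrightarrow>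
      (a \<oplus> b) \<odot>\<^bsub>M\<^esub> x = a \<odot>\<^bsub>M\<^esub> x \<oplus>\<^bsub>M\<^esub> b \<odot>\<^bsub>M\<^esub> x"
    and smult_r_distr:
      "\<lbrakk>a \<in> carrier R; x \<in> carrier M; y \<in> carrier M\<rbrakk> \<Longrightarrow>
      a \<odot>\<^bsub>M\<^esub> (x \<oplus>\<^bsub>M\<^esub> y) = a \<odot>\<^bsub>M\<^esub> x \<oplus>\<^bsub>M\<^esub> a \<odot>\<^bsub>M\<^esub> y"
    and smult_assoc1:
      "\<lbrakk>a \<in> carrier R; b \<in> carrier R; x \<in> carrier M\<rbrakk> \<Longrightarrow>
      (a \<otimes> b) \<odot>\<^bsub>M\<^esub> x = a \<odot>\<^bsub>M\<^esub> (b \<odot>\<^bsub>M\<^esub> x)"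
    and smult_one [simp]:
      "x \<in> carrier M \<Longrightarrow> \<one> \<odot>\<^bsub>M\<^esub> x = x"

definition left_ideal_module :: "('b, 's) ring_scheme \<Rightarrow> 'b set \<Rightarrow> ('b, 'b) module" where
  "left_ideal_module S I = \<lparr>carrier = I, monoid.mult = monoid.mult S, one = one S,
     zero = zero S, add = add S, smult = monoid.mult S\<rparr>"

definition module_hom ::
  "('s, 'r) ring_scheme \<Rightarrow> ('s, 'm, 'x) module_scheme \<Rightarrow> ('s, 'n, 'y) module_scheme \<Rightarrow> ('m \<Rightarrow> 'n) set"
where
  "module_hom S M N = {h \<in> carrier M \<rightarrow> carrier N.
     (\<forall>x\<in>carrier M. \<forall>y\<in>carrier M. h (x \<oplus>\<^bsub>M\<^esub> y) = h x \<oplus>\<^bsub>N\<^esub> h y) \<and>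
     (\<forall>s\<in>carrier S. \<forall>x\<in>carrier M. h (s \<odot>\<^bsub>M\<^esub> x) = s \<odot>\<^bsub>N\<^esub> h x)}"

definition short_exact ::
  "('s, 'r) ring_scheme \<Rightarrow> ('s, 'm) module \<Rightarrow> ('m \<Rightarrow> 'n) \<Rightarrow> ('s, 'n) module \<Rightarrow> ('n \<Rightarrow> 'c) \<Rightarrow>
   ('s, 'c) module \<Rightarrow> bool"
where
  "short_exact S M f N \<phi> C \<longleftrightarrow>
     left_module S M \<and> left_module S N \<and> left_module S C \<and>
     f \<in> module_hom S M N \<and> \<phi> \<in> module_hom S N C \<and>
     inj_on f (carrier M) \<and> f ` carrier M = {x \<in> carrier N. \<phi> x = \<zero>\<^bsub>C\<^esub>} \<and>
     \<phi> ` carrier N = carrier C"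

definition has_section ::
  "('s, 'r) ring_scheme \<Rightarrow> ('s, 'n) module \<Rightarrow> ('n \<Rightarrow> 'c) \<Rightarrow> ('s, 'c) module \<Rightarrow> bool"
where
  "has_section S N \<phi> C \<longleftrightarrow> (\<exists>\<psi>\<in>module_hom S C N. \<forall>c\<in>carrier C. \<phi> (\<psi> c) = c)"

definition restrict_scalars :: "('r \<Rightarrow> 's) \<Rightarrow> ('s, 'm) module \<Rightarrow> ('r, 'm) module" where
  "restrict_scalars \<iota> M = \<lparr>carrier = carrier M, monoid.mult = monoid.mult M, one = one M,
     zero = zero M, add = add M, smult = (\<lambda>r x. \<iota> r \<odot>\<^bsub>M\<^esub> x)\<rparr>"


section \<open>Relative projectivity\<close>

text \<open>Relative projectivity for the trivial subgroup, tested on the short exact sequences whose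
  modules live in the types \<open>'m\<close> and \<open>'n\<close>.\<close>

definition relative_projective_on ::
  "'m itself \<Rightarrow> 'n itself \<Rightarrow> ('a, 'r) ring_scheme \<Rightarrow> ('g, 'x) monoid_scheme \<Rightarrow> ('g \<Rightarrow> 'a) set \<Rightarrow> bool"
where
  "relative_projective_on m n R G C \<longleftrightarrow>
     (let S = group_ring R G; CM = left_ideal_module S C in
      \<forall>(M :: ('g \<Rightarrow> 'a, 'm) module) (N :: ('g \<Rightarrow> 'a, 'n) module) f \<phi>.
        short_exact S M f N \<phi> CM \<longrightarrow>
        has_section R (restrict_scalars (gr_const R G) N) \<phi> (restrict_scalars (gr_const R G) CM) \<longrightarrow>
        has_section S N \<phi> CM)"

text \<open>A formula cannot quantify over types. The type below is large enough: by
  \<open>relative_projective_on_all_types\<close>, the condition for it implies the condition for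
  all types \<open>'m\<close> and \<open>'n\<close>.\<close>

definition relative_projective ::
  "('a, 'r) ring_scheme \<Rightarrow> ('g, 'x) monoid_scheme \<Rightarrow> ('g \<Rightarrow> 'a) set \<Rightarrow> bool"
where
  "relative_projective R G C \<longleftrightarrow>
     relative_projective_on TYPE(('g \<Rightarrow> 'a) \<Rightarrow> ('g \<Rightarrow> 'a)) TYPE(('g \<Rightarrow> 'a) \<Rightarrow> ('g \<Rightarrow> 'a)) R G C"

lemma (in left_module) smult_finsum:
  assumes "finite A" "a \<in> carrier R" "f \<in> A \<rightarrow> carrier M"
  shows "a \<odot>\<^bsub>M\<^esub> finsum M f A = finsum M (\<lambda>i. a \<odot>\<^bsub>M\<^esub> f i) A"
  using assms(1,3)
proof (induction A)
  case empty
  have "a \<odot>\<^bsub>M\<^esub> \<zero>\<^bsub>M\<^esub> = \<zero>\<^bsub>M\<^esub>"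
    using smult_r_distr[OF assms(2), of "\<zero>\<^bsub>M\<^esub>" "\<zero>\<^bsub>M\<^esub>"] assms(2) by simp
  thus ?case by simp
next
  case (insert i A)
  have "f i \<in> carrier M" "f \<in> A \<rightarrow> carrier M" "finsum M f A \<in> carrier M"
    using insert.prems by (auto intro!: M.finsum_closed)
  moreover have "(\<lambda>i. a \<odot>\<^bsub>M\<^esub> f i) \<in> A \<rightarrow> carrier M" using insert.prems assms(2) by auto
  ultimately show ?case using insert.IH insert.hyps assms(2)
    by (simp add: smult_r_distr)
qed

lemma (in abelian_monoid) finsum_swap:
  assumes "finite A" "finite B" "\<And>i j. i \<in> A \<Longrightarrow> j \<in> B \<Longrightarrow> f i j \<in> carrier G"
  shows "(\<Oplus>i\<in>A. \<Oplus>j\<in>B. f i j) = (\<Oplus>j\<in>B. \<Oplus>i\<in>A. f i j)"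
  using assms(1,3)
proof (induction A)
  case (insert a A)
  have "(\<Oplus>i\<in>insert a A. \<Oplus>j\<in>B. f i j) = (\<Oplus>j\<in>B. f a j) \<oplus> (\<Oplus>j\<in>B. \<Oplus>i\<in>A. f i j)"
    using insert by (subst finsum_insert) (auto intro!: finsum_closed)
  also have "\<dots> = (\<Oplus>j\<in>B. f a j \<oplus> (\<Oplus>i\<in>A. f i j))"
    using insert by (subst finsum_addf) (auto intro!: finsum_closed)
  also have "\<dots> = (\<Oplus>j\<in>B. \<Oplus>i\<in>insert a A. f i j)"
    using insert by (intro finsum_cong') (auto intro!: finsum_closed)
  finally show ?case .
qed simp

locale group_ring_ctx = R: cring R + G: group G
  for R (structure) and G (structure) +
  assumes fin: "finite (carrier G)"
begin

abbreviation "S \<equiv> group_ring R G"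
abbreviation "con \<equiv> gr_const R G"

definition "bas h = (\<lambda>x\<in>carrier G. if x = h then \<one>\<^bsub>R\<^esub> else \<zero>\<^bsub>R\<^esub>)"

lemma gr_closed: "a \<in> carrier S \<Longrightarrow> x \<in> carrier G \<Longrightarrow> a x \<in> carrier R"
  by (auto simp: group_ring_def)

lemma gr_eqI:
  assumes "a \<in> carrier S" "b \<in> carrier S" "\<And>x. x \<in> carrier G \<Longrightarrow> a x = b x"
  shows "a = b"
  using assms by (auto simp: group_ring_def intro: PiE_ext)

lemma gr_mult: "x \<in> carrier G \<Longrightarrow>
    (a \<otimes>\<^bsub>S\<^esub> b) x = (\<Oplus>\<^bsub>R\<^esub>y\<in>carrier G. a y \<otimes>\<^bsub>R\<^esub> b (inv\<^bsub>G\<^esub> y \<otimes>\<^bsub>G\<^esub> x))"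
  by (simp add: group_ring_def)

lemma gr_add: "x \<in> carrier G \<Longrightarrow> (a \<oplus>\<^bsub>S\<^esub> b) x = a x \<oplus>\<^bsub>R\<^esub> b x"
  by (simp add: group_ring_def)

lemma gr_zero: "x \<in> carrier G \<Longrightarrow> \<zero>\<^bsub>S\<^esub> x = \<zero>\<^bsub>R\<^esub>"
  by (simp add: group_ring_def)

lemma gr_one: "\<one>\<^bsub>S\<^esub> = bas \<one>\<^bsub>G\<^esub>"
  by (simp add: group_ring_def bas_def)

lemma gr_mult_closed: "a \<in> carrier S \<Longrightarrow> b \<in> carrier S \<Longrightarrow> a \<otimes>\<^bsub>S\<^esub> b \<in> carrier S"
  by (auto simp: group_ring_def intro!: R.finsum_closed)

lemma gr_add_closed: "a \<in> carrier S \<Longrightarrow> b \<in> carrier S \<Longrightarrow> a \<oplus>\<^bsub>S\<^esub> b \<in> carrier S"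
  by (auto simp: group_ring_def)

lemma gr_zero_closed: "\<zero>\<^bsub>S\<^esub> \<in> carrier S"
  by (auto simp: group_ring_def)

lemma bas_closed: "bas h \<in> carrier S"
  by (auto simp: group_ring_def bas_def)

lemma con_closed: "r \<in> carrier R \<Longrightarrow> con r \<in> carrier S"
  by (auto simp: group_ring_def gr_const_def)

lemma single_sum:
  assumes "h \<in> carrier G" "f \<in> carrier G \<rightarrow> carrier R"
  shows "(\<Oplus>\<^bsub>R\<^esub>y\<in>carrier G. if y = h then f y else \<zero>\<^bsub>R\<^esub>) = f h"
  using R.finsum_singleton[OF assms(1) fin assms(2)] by (simp add: eq_commute)

lemma bas_mult:
  assumes "h \<in> carrier G" "a \<in> carrier S" "x \<in> carrier G"
  shows "(bas h \<otimes>\<^bsub>S\<^esub> a) x = a (inv\<^bsub>G\<^esub> h \<otimes>\<^bsub>G\<^esub> x)"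
proof -
  have "(bas h \<otimes>\<^bsub>S\<^esub> a) x = (\<Oplus>\<^bsub>R\<^esub>y\<in>carrier G. if y = h then a (inv\<^bsub>G\<^esub> y \<otimes>\<^bsub>G\<^esub> x) else \<zero>\<^bsub>R\<^esub>)"
    unfolding gr_mult[OF assms(3)] bas_def
    using assms gr_closed by (intro R.finsum_cong') auto
  also have "\<dots> = a (inv\<^bsub>G\<^esub> h \<otimes>\<^bsub>G\<^esub> x)"
    using assms gr_closed by (subst single_sum) auto
  finally show ?thesis .
qed

lemma con_mult:
  assumes "r \<in> carrier R" "a \<in> carrier S" "x \<in> carrier G"
  shows "(con r \<otimes>\<^bsub>S\<^esub> a) x = r \<otimes>\<^bsub>R\<^esub> a x"
proof -
  have "(con r \<otimes>\<^bsub>S\<^esub> a) x =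
      (\<Oplus>\<^bsub>R\<^esub>y\<in>carrier G. if y = \<one>\<^bsub>G\<^esub> then r \<otimes>\<^bsub>R\<^esub> a (inv\<^bsub>G\<^esub> y \<otimes>\<^bsub>G\<^esub> x) else \<zero>\<^bsub>R\<^esub>)"
    unfolding gr_mult[OF assms(3)] gr_const_def
    using assms gr_closed by (intro R.finsum_cong') auto
  also have "\<dots> = r \<otimes>\<^bsub>R\<^esub> a (inv\<^bsub>G\<^esub> \<one>\<^bsub>G\<^esub> \<otimes>\<^bsub>G\<^esub> x)"
    using assms gr_closed by (subst single_sum) auto
  finally show ?thesis using assms by simp
qed

lemma mult_con:
  assumes "r \<in> carrier R" "a \<in> carrier S" "x \<in> carrier G"
  shows "(a \<otimes>\<^bsub>S\<^esub> con r) x = a x \<otimes>\<^bsub>R\<^esub> r"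
proof -
  have *: "inv\<^bsub>G\<^esub> y \<otimes>\<^bsub>G\<^esub> x = \<one>\<^bsub>G\<^esub> \<longleftrightarrow> y = x" if "y \<in> carrier G" for y
    using that assms(3) by (metis G.inv_closed G.inv_equality G.inv_inv G.l_inv)
  have "(a \<otimes>\<^bsub>S\<^esub> con r) x = (\<Oplus>\<^bsub>R\<^esub>y\<in>carrier G. if y = x then a y \<otimes>\<^bsub>R\<^esub> r else \<zero>\<^bsub>R\<^esub>)"
    unfolding gr_mult[OF assms(3)] gr_const_def
    using assms gr_closed * by (intro R.finsum_cong') auto
  also have "\<dots> = a x \<otimes>\<^bsub>R\<^esub> r"
    using assms gr_closed by (subst single_sum) auto
  finally show ?thesis .
qed

lemma con_central:
  assumes "r \<in> carrier R" "a \<in> carrier S"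
  shows "con r \<otimes>\<^bsub>S\<^esub> a = a \<otimes>\<^bsub>S\<^esub> con r"
  using assms
  by (intro gr_eqI) (auto simp: gr_mult_closed con_closed con_mult mult_con gr_closed R.m_comm)

lemma con_one: "con \<one>\<^bsub>R\<^esub> = \<one>\<^bsub>S\<^esub>"
  by (simp add: gr_const_def gr_one bas_def)

lemma gr_assoc:
  assumes "a \<in> carrier S" "b \<in> carrier S" "c \<in> carrier S"
  shows "(a \<otimes>\<^bsub>S\<^esub> b) \<otimes>\<^bsub>S\<^esub> c = a \<otimes>\<^bsub>S\<^esub> (b \<otimes>\<^bsub>S\<^esub> c)"
proof (rule gr_eqI)
  fix x assume x: "x \<in> carrier G"
  note cl = assms[THEN gr_closed]
  have "((a \<otimes>\<^bsub>S\<^esub> b) \<otimes>\<^bsub>S\<^esub> c) x = (\<Oplus>\<^bsub>R\<^esub>y\<in>carrier G. (\<Oplus>\<^bsub>R\<^esub>z\<in>carrier G.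
      a z \<otimes>\<^bsub>R\<^esub> b (inv\<^bsub>G\<^esub> z \<otimes>\<^bsub>G\<^esub> y)) \<otimes>\<^bsub>R\<^esub> c (inv\<^bsub>G\<^esub> y \<otimes>\<^bsub>G\<^esub> x))"
    unfolding gr_mult[OF x] using x cl
    by (intro R.finsum_cong') (auto simp: gr_mult intro!: R.finsum_closed)
  also have "\<dots> = (\<Oplus>\<^bsub>R\<^esub>y\<in>carrier G. \<Oplus>\<^bsub>R\<^esub>z\<in>carrier G.
      a z \<otimes>\<^bsub>R\<^esub> b (inv\<^bsub>G\<^esub> z \<otimes>\<^bsub>G\<^esub> y) \<otimes>\<^bsub>R\<^esub> c (inv\<^bsub>G\<^esub> y \<otimes>\<^bsub>G\<^esub> x))"
    using x cl fin
    by (intro R.finsum_cong' R.finsum_ldistr) (auto intro!: R.finsum_closed)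
  also have "\<dots> = (\<Oplus>\<^bsub>R\<^esub>z\<in>carrier G. \<Oplus>\<^bsub>R\<^esub>y\<in>carrier G.
      a z \<otimes>\<^bsub>R\<^esub> b (inv\<^bsub>G\<^esub> z \<otimes>\<^bsub>G\<^esub> y) \<otimes>\<^bsub>R\<^esub> c (inv\<^bsub>G\<^esub> y \<otimes>\<^bsub>G\<^esub> x))"
    using x cl fin by (intro R.finsum_swap) auto
  also have "\<dots> = (\<Oplus>\<^bsub>R\<^esub>z\<in>carrier G. a z \<otimes>\<^bsub>R\<^esub> (b \<otimes>\<^bsub>S\<^esub> c) (inv\<^bsub>G\<^esub> z \<otimes>\<^bsub>G\<^esub> x))"
  proof (intro R.finsum_cong')
    fix z assume z: "z \<in> carrier G"
    have bij: "(\<lambda>w. z \<otimes>\<^bsub>G\<^esub> w) ` carrier G = carrier G"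
      using z by (simp add: G.surj_const_mult)
    have inj: "inj_on (\<lambda>w. z \<otimes>\<^bsub>G\<^esub> w) (carrier G)"
      using z by (simp add: G.inj_on_cmult)
    have "(\<Oplus>\<^bsub>R\<^esub>y\<in>carrier G. a z \<otimes>\<^bsub>R\<^esub> b (inv\<^bsub>G\<^esub> z \<otimes>\<^bsub>G\<^esub> y) \<otimes>\<^bsub>R\<^esub> c (inv\<^bsub>G\<^esub> y \<otimes>\<^bsub>G\<^esub> x)) =
        (\<Oplus>\<^bsub>R\<^esub>y\<in>(\<lambda>w. z \<otimes>\<^bsub>G\<^esub> w) ` carrier G.
          a z \<otimes>\<^bsub>R\<^esub> b (inv\<^bsub>G\<^esub> z \<otimes>\<^bsub>G\<^esub> y) \<otimes>\<^bsub>R\<^esub> c (inv\<^bsub>G\<^esub> y \<otimes>\<^bsub>G\<^esub> x))"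
      by (simp add: bij)
    also have "\<dots> = (\<Oplus>\<^bsub>R\<^esub>w\<in>carrier G.
        a z \<otimes>\<^bsub>R\<^esub> b (inv\<^bsub>G\<^esub> z \<otimes>\<^bsub>G\<^esub> (z \<otimes>\<^bsub>G\<^esub> w)) \<otimes>\<^bsub>R\<^esub> c (inv\<^bsub>G\<^esub> (z \<otimes>\<^bsub>G\<^esub> w) \<otimes>\<^bsub>G\<^esub> x))"
      using x z cl inj by (intro R.finsum_reindex) auto
    also have "\<dots> = (\<Oplus>\<^bsub>R\<^esub>w\<in>carrier G.
        a z \<otimes>\<^bsub>R\<^esub> (b w \<otimes>\<^bsub>R\<^esub> c (inv\<^bsub>G\<^esub> w \<otimes>\<^bsub>G\<^esub> (inv\<^bsub>G\<^esub> z \<otimes>\<^bsub>G\<^esub> x))))"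
      using x z cl
      by (intro R.finsum_cong')
        (auto simp: G.inv_mult_group G.m_assoc R.m_assoc simp flip: G.m_assoc[of "inv\<^bsub>G\<^esub> z" z])
    also have "\<dots> = a z \<otimes>\<^bsub>R\<^esub> (b \<otimes>\<^bsub>S\<^esub> c) (inv\<^bsub>G\<^esub> z \<otimes>\<^bsub>G\<^esub> x)"
      using x z cl fin by (subst R.finsum_rdistr[symmetric]) (auto simp: gr_mult)
    finally show "(\<Oplus>\<^bsub>R\<^esub>y\<in>carrier G. a z \<otimes>\<^bsub>R\<^esub> b (inv\<^bsub>G\<^esub> z \<otimes>\<^bsub>G\<^esub> y) \<otimes>\<^bsub>R\<^esub> c (inv\<^bsub>G\<^esub> y \<otimes>\<^bsub>G\<^esub> x)) =
      a z \<otimes>\<^bsub>R\<^esub> (b \<otimes>\<^bsub>S\<^esub> c) (inv\<^bsub>G\<^esub> z \<otimes>\<^bsub>G\<^esub> x)" .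
  qed (use x cl gr_closed[OF gr_mult_closed[OF assms(2,3)]] in auto)
  also have "\<dots> = (a \<otimes>\<^bsub>S\<^esub> (b \<otimes>\<^bsub>S\<^esub> c)) x"
    by (simp add: gr_mult[OF x])
  finally show "((a \<otimes>\<^bsub>S\<^esub> b) \<otimes>\<^bsub>S\<^esub> c) x = (a \<otimes>\<^bsub>S\<^esub> (b \<otimes>\<^bsub>S\<^esub> c)) x" .
qed (use assms in \<open>auto intro!: gr_mult_closed\<close>)

lemma gr_ring: "ring S"
proof (rule ringI)
  show "abelian_group S"
  proof (rule abelian_groupI)
    fix a assume a: "a \<in> carrier S"
    have "(\<lambda>x\<in>carrier G. \<ominus>\<^bsub>R\<^esub> a x) \<in> carrier S"
      using gr_closed[OF a] by (auto simp: group_ring_def)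
    moreover have "(\<lambda>x\<in>carrier G. \<ominus>\<^bsub>R\<^esub> a x) \<oplus>\<^bsub>S\<^esub> a = \<zero>\<^bsub>S\<^esub>"
      using gr_closed[OF a] by (auto simp: group_ring_def R.l_neg)
    ultimately show "\<exists>b\<in>carrier S. b \<oplus>\<^bsub>S\<^esub> a = \<zero>\<^bsub>S\<^esub>" by blast
  qed (auto intro!: gr_eqI simp: gr_add_closed gr_zero_closed gr_add gr_zero gr_closed
        R.add.m_ac)
  show "Group.monoid S"
  proof (rule monoidI)
    show "\<one>\<^bsub>S\<^esub> \<otimes>\<^bsub>S\<^esub> a = a" if "a \<in> carrier S" for a
      using that by (intro gr_eqI) (auto simp: gr_one bas_closed gr_mult_closed bas_mult)
    show "a \<otimes>\<^bsub>S\<^esub> \<one>\<^bsub>S\<^esub> = a" if "a \<in> carrier S" for a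
      using that by (intro gr_eqI)
        (auto simp: gr_mult_closed mult_con con_closed gr_closed simp flip: con_one)
  qed (auto simp: gr_mult_closed gr_one bas_closed gr_assoc)
next
  fix a b c assume abc: "a \<in> carrier S" "b \<in> carrier S" "c \<in> carrier S"
  note cl = abc[THEN gr_closed]
  show "(a \<oplus>\<^bsub>S\<^esub> b) \<otimes>\<^bsub>S\<^esub> c = a \<otimes>\<^bsub>S\<^esub> c \<oplus>\<^bsub>S\<^esub> b \<otimes>\<^bsub>S\<^esub> c"
  proof (rule gr_eqI)
    fix x assume x: "x \<in> carrier G"
    show "((a \<oplus>\<^bsub>S\<^esub> b) \<otimes>\<^bsub>S\<^esub> c) x = (a \<otimes>\<^bsub>S\<^esub> c \<oplus>\<^bsub>S\<^esub> b \<otimes>\<^bsub>S\<^esub> c) x"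
      unfolding gr_add[OF x] gr_mult[OF x] using x cl
      by (auto simp: R.finsum_addf[symmetric] gr_add R.l_distr simp del: R.finsum_addf
            intro!: R.finsum_cong')
  qed (use abc in \<open>auto intro!: gr_mult_closed gr_add_closed\<close>)
  show "c \<otimes>\<^bsub>S\<^esub> (a \<oplus>\<^bsub>S\<^esub> b) = c \<otimes>\<^bsub>S\<^esub> a \<oplus>\<^bsub>S\<^esub> c \<otimes>\<^bsub>S\<^esub> b"
  proof (rule gr_eqI)
    fix x assume x: "x \<in> carrier G"
    show "(c \<otimes>\<^bsub>S\<^esub> (a \<oplus>\<^bsub>S\<^esub> b)) x = (c \<otimes>\<^bsub>S\<^esub> a \<oplus>\<^bsub>S\<^esub> c \<otimes>\<^bsub>S\<^esub> b) x"
      unfolding gr_add[OF x] gr_mult[OF x] using x cl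
      by (auto simp: R.finsum_addf[symmetric] gr_add R.r_distr simp del: R.finsum_addf
            intro!: R.finsum_cong')
  qed (use abc in \<open>auto intro!: gr_mult_closed gr_add_closed\<close>)
qed

sublocale S: ring S
  by (rule gr_ring)

lemma bas_bas:
  assumes "g \<in> carrier G" "h \<in> carrier G"
  shows "bas g \<otimes>\<^bsub>S\<^esub> bas h = bas (g \<otimes>\<^bsub>G\<^esub> h)"
proof (rule gr_eqI)
  fix x assume x: "x \<in> carrier G"
  have "inv\<^bsub>G\<^esub> g \<otimes>\<^bsub>G\<^esub> x = h \<longleftrightarrow> x = g \<otimes>\<^bsub>G\<^esub> h"
    using assms x by (metis G.inv_solve_left)
  thus "(bas g \<otimes>\<^bsub>S\<^esub> bas h) x = bas (g \<otimes>\<^bsub>G\<^esub> h) x"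
    using assms x by (auto simp: bas_mult bas_closed) (auto simp: bas_def)
qed (auto simp: bas_closed)

lemma finsum_apply:
  assumes "finite A" "F \<in> A \<rightarrow> carrier S" "x \<in> carrier G"
  shows "finsum S F A x = (\<Oplus>\<^bsub>R\<^esub>i\<in>A. F i x)"
  using assms(1,2)
proof (induction A)
  case (insert i A)
  have "F i x \<in> carrier R" "(\<lambda>i. F i x) \<in> A \<rightarrow> carrier R"
    using insert.prems assms(3) by (auto intro!: gr_closed)
  thus ?case using insert assms(3) by (simp add: gr_add)
qed (simp add: gr_zero assms)

lemma decomposition:
  assumes "a \<in> carrier S"
  shows "a = (\<Oplus>\<^bsub>S\<^esub>h\<in>carrier G. con (a h) \<otimes>\<^bsub>S\<^esub> bas h)"
proof (rule gr_eqI)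
  have F: "(\<lambda>h. con (a h) \<otimes>\<^bsub>S\<^esub> bas h) \<in> carrier G \<rightarrow> carrier S"
    using assms gr_closed con_closed bas_closed by blast
  thus "(\<Oplus>\<^bsub>S\<^esub>h\<in>carrier G. con (a h) \<otimes>\<^bsub>S\<^esub> bas h) \<in> carrier S" by simp
  fix x assume x: "x \<in> carrier G"
  have "(\<Oplus>\<^bsub>S\<^esub>h\<in>carrier G. con (a h) \<otimes>\<^bsub>S\<^esub> bas h) x = (\<Oplus>\<^bsub>R\<^esub>h\<in>carrier G. if h = x then a h else \<zero>\<^bsub>R\<^esub>)"
    unfolding finsum_apply[OF fin F x] using x gr_closed[OF assms]
    by (intro R.finsum_cong') (auto simp: con_mult bas_closed, auto simp: bas_def)
  also have "\<dots> = a x" using x gr_closed[OF assms] by (intro single_sum) auto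
  finally show "a x = (\<Oplus>\<^bsub>S\<^esub>h\<in>carrier G. con (a h) \<otimes>\<^bsub>S\<^esub> bas h) x" ..
qed fact

lemma gr_induct [consumes 1, case_names zero add gen]:
  assumes "a \<in> carrier S" "P \<zero>\<^bsub>S\<^esub>"
    and "\<And>a b. a \<in> carrier S \<Longrightarrow> b \<in> carrier S \<Longrightarrow> P a \<Longrightarrow> P b \<Longrightarrow> P (a \<oplus>\<^bsub>S\<^esub> b)"
    and "\<And>r h. r \<in> carrier R \<Longrightarrow> h \<in> carrier G \<Longrightarrow> P (con r \<otimes>\<^bsub>S\<^esub> bas h)"
  shows "P a"
proof -
  have "P (\<Oplus>\<^bsub>S\<^esub>h\<in>A. con (a h) \<otimes>\<^bsub>S\<^esub> bas h)" if "finite A" "A \<subseteq> carrier G" for A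
    using that
  proof (induction A)
    case (insert h A)
    have *: "con (a i) \<otimes>\<^bsub>S\<^esub> bas i \<in> carrier S" if "i \<in> carrier G" for i
      using that assms(1) gr_closed con_closed bas_closed by blast
    hence "(\<lambda>i. con (a i) \<otimes>\<^bsub>S\<^esub> bas i) \<in> A \<rightarrow> carrier S" using insert by auto
    thus ?case using insert * assms(1) gr_closed
      by (auto intro!: assms(3,4))
  qed (simp add: assms)
  from this[OF fin subset_refl] show ?thesis using decomposition[OF assms(1)] by simp
qed

definition avg where
  "avg A B T c = (\<Oplus>\<^bsub>B\<^esub>g\<in>carrier G. bas (inv\<^bsub>G\<^esub> g) \<odot>\<^bsub>B\<^esub> T (bas g \<odot>\<^bsub>A\<^esub> c))"

lemma avg_hom:
  fixes A B
  assumes A: "left_module S A" and B: "left_module S B"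
    and T: "T \<in> module_hom R (restrict_scalars con A) (restrict_scalars con B)"
  shows "avg A B T \<in> module_hom S A B"
proof -
  interpret A: left_module S A by fact
  interpret B: left_module S B by fact
  have Tc: "T c \<in> carrier B" if "c \<in> carrier A" for c
    using T that by (auto simp: module_hom_def restrict_scalars_def)
  have Ta: "T (c \<oplus>\<^bsub>A\<^esub> d) = T c \<oplus>\<^bsub>B\<^esub> T d" if "c \<in> carrier A" "d \<in> carrier A" for c d
    using T that by (auto simp: module_hom_def restrict_scalars_def)
  have Tr: "T (con r \<odot>\<^bsub>A\<^esub> c) = con r \<odot>\<^bsub>B\<^esub> T c" if "c \<in> carrier A" "r \<in> carrier R" for c r
    using T that by (auto simp: module_hom_def restrict_scalars_def)
  have closed: "avg A B T c \<in> carrier B" if "c \<in> carrier A" for c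
    unfolding avg_def using that by (auto intro!: B.M.finsum_closed B.smult_closed Tc bas_closed)
  have add: "avg A B T (c \<oplus>\<^bsub>A\<^esub> d) = avg A B T c \<oplus>\<^bsub>B\<^esub> avg A B T d"
    if "c \<in> carrier A" "d \<in> carrier A" for c d
    unfolding avg_def using that
    by (subst B.M.finsum_addf[symmetric])
      (auto intro!: B.M.finsum_cong' B.M.a_closed B.smult_closed
         simp: Tc Ta A.smult_r_distr B.smult_r_distr bas_closed)
  have con: "avg A B T (con r \<odot>\<^bsub>A\<^esub> c) = con r \<odot>\<^bsub>B\<^esub> avg A B T c"
    if c: "c \<in> carrier A" and r: "r \<in> carrier R" for c r
  proof -
    have "bas (inv\<^bsub>G\<^esub> g) \<odot>\<^bsub>B\<^esub> T (bas g \<odot>\<^bsub>A\<^esub> (con r \<odot>\<^bsub>A\<^esub> c)) =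
        con r \<odot>\<^bsub>B\<^esub> (bas (inv\<^bsub>G\<^esub> g) \<odot>\<^bsub>B\<^esub> T (bas g \<odot>\<^bsub>A\<^esub> c))" if g: "g \<in> carrier G" for g
    proof -
      have "bas g \<odot>\<^bsub>A\<^esub> (con r \<odot>\<^bsub>A\<^esub> c) = con r \<odot>\<^bsub>A\<^esub> (bas g \<odot>\<^bsub>A\<^esub> c)"
        using c r g by (simp flip: A.smult_assoc1 add: bas_closed con_closed con_central)
      moreover have "bas (inv\<^bsub>G\<^esub> g) \<odot>\<^bsub>B\<^esub> (con r \<odot>\<^bsub>B\<^esub> T (bas g \<odot>\<^bsub>A\<^esub> c)) =
          con r \<odot>\<^bsub>B\<^esub> (bas (inv\<^bsub>G\<^esub> g) \<odot>\<^bsub>B\<^esub> T (bas g \<odot>\<^bsub>A\<^esub> c))"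
        using c r g by (simp flip: B.smult_assoc1 add: Tc bas_closed con_closed con_central)
      ultimately show ?thesis using c r g by (simp add: Tr bas_closed)
    qed
    thus ?thesis unfolding avg_def using c r
      by (subst B.smult_finsum)
        (auto intro!: B.M.finsum_cong' B.smult_closed Tc A.smult_closed bas_closed con_closed fin)
  qed
  have bas: "avg A B T (bas h \<odot>\<^bsub>A\<^esub> c) = bas h \<odot>\<^bsub>B\<^esub> avg A B T c"
    if c: "c \<in> carrier A" and h: "h \<in> carrier G" for c h
  proof -
    let ?f = "\<lambda>k. bas (h \<otimes>\<^bsub>G\<^esub> inv\<^bsub>G\<^esub> k) \<odot>\<^bsub>B\<^esub> T (bas k \<odot>\<^bsub>A\<^esub> c)"
    have f: "?f \<in> carrier G \<rightarrow> carrier B" using c h by (auto intro!: Tc bas_closed)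
    have inj: "inj_on (\<lambda>g. g \<otimes>\<^bsub>G\<^esub> h) (carrier G)"
      using h by (rule G.inj_on_multc)
    hence img: "(\<lambda>g. g \<otimes>\<^bsub>G\<^esub> h) ` carrier G = carrier G"
      using h by (intro endo_inj_surj[OF fin]) auto
    have "bas h \<odot>\<^bsub>B\<^esub> avg A B T c = finsum B ?f (carrier G)"
      unfolding avg_def using c h f
      by (subst B.smult_finsum)
        (auto intro!: B.M.finsum_cong' B.smult_closed Tc bas_closed fin
           simp flip: B.smult_assoc1 simp: bas_bas bas_closed Tc)
    also have "\<dots> = finsum B ?f ((\<lambda>g. g \<otimes>\<^bsub>G\<^esub> h) ` carrier G)" by (simp add: img)
    also have "\<dots> = (\<Oplus>\<^bsub>B\<^esub>g\<in>carrier G. ?f (g \<otimes>\<^bsub>G\<^esub> h))"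
      using f h inj by (intro B.M.finsum_reindex) auto
    also have "\<dots> = avg A B T (bas h \<odot>\<^bsub>A\<^esub> c)"
      unfolding avg_def
    proof (intro B.M.finsum_cong')
      fix g assume g: "g \<in> carrier G"
      have "h \<otimes>\<^bsub>G\<^esub> inv\<^bsub>G\<^esub> (g \<otimes>\<^bsub>G\<^esub> h) = inv\<^bsub>G\<^esub> g"
        using g h by (simp add: G.inv_mult_group G.inv_solve_left' flip: G.m_assoc)
      thus "?f (g \<otimes>\<^bsub>G\<^esub> h) = bas (inv\<^bsub>G\<^esub> g) \<odot>\<^bsub>B\<^esub> T (bas g \<odot>\<^bsub>A\<^esub> (bas h \<odot>\<^bsub>A\<^esub> c))"
        using g h c by (simp flip: A.smult_assoc1 add: bas_bas bas_closed)
    qed (use c h in \<open>auto intro!: Tc bas_closed\<close>)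
    finally show ?thesis ..
  qed
  have zero: "\<zero>\<^bsub>S\<^esub> \<odot>\<^bsub>A\<^esub> c = \<zero>\<^bsub>A\<^esub>" if "c \<in> carrier A" for c
    using A.smult_l_distr[of "\<zero>\<^bsub>S\<^esub>" "\<zero>\<^bsub>S\<^esub>" c] that by simp
  have zeroB: "\<zero>\<^bsub>S\<^esub> \<odot>\<^bsub>B\<^esub> c = \<zero>\<^bsub>B\<^esub>" if "c \<in> carrier B" for c
    using B.smult_l_distr[of "\<zero>\<^bsub>S\<^esub>" "\<zero>\<^bsub>S\<^esub>" c] that by simp
  have "avg A B T (s \<odot>\<^bsub>A\<^esub> c) = s \<odot>\<^bsub>B\<^esub> avg A B T c" if "s \<in> carrier S" "c \<in> carrier A" for s c
    using that(1)
  proof (induction s rule: gr_induct)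
    case zero
    have "avg A B T \<zero>\<^bsub>A\<^esub> \<oplus>\<^bsub>B\<^esub> avg A B T \<zero>\<^bsub>A\<^esub> = avg A B T \<zero>\<^bsub>A\<^esub>"
      using add[of "\<zero>\<^bsub>A\<^esub>" "\<zero>\<^bsub>A\<^esub>"] by simp
    hence "avg A B T \<zero>\<^bsub>A\<^esub> = \<zero>\<^bsub>B\<^esub>" using closed by simp
    thus ?case using \<open>\<And>c. c \<in> carrier A \<Longrightarrow> \<zero>\<^bsub>S\<^esub> \<odot>\<^bsub>A\<^esub> c = \<zero>\<^bsub>A\<^esub>\<close> that zeroB closed by simp
  next
    case (add a b)
    thus ?case using that \<open>\<And>c d. c \<in> carrier A \<Longrightarrow> d \<in> carrier A \<Longrightarrow> avg A B T (c \<oplus>\<^bsub>A\<^esub> d) = avg A B T c \<oplus>\<^bsub>B\<^esub> avg A B T d\<close>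
      by (simp add: A.smult_l_distr B.smult_l_distr closed)
  next
    case (gen r h)
    thus ?case using that closed
      by (simp add: A.smult_assoc1 B.smult_assoc1 con_closed bas_closed con bas)
  qed
  thus ?thesis using closed add by (auto simp: module_hom_def)
qed

lemma left_ideal_left_module:
  assumes "left_ideal I S"
  shows "left_module S (left_ideal_module S I)"
proof -
  interpret I: additive_subgroup I S using assms by (simp add: left_ideal_def)
  have mult: "a \<otimes>\<^bsub>S\<^esub> x \<in> I" if "a \<in> carrier S" "x \<in> I" for a x
    using assms that by (simp add: left_ideal_def)
  have sub: "x \<in> I \<Longrightarrow> x \<in> carrier S" for x by (rule I.a_Hcarr)
  show ?thesis
    unfolding left_module_def left_module_axioms_def
  proof (intro conjI gr_ring)
    show "abelian_group (left_ideal_module S I)"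
    proof (rule abelian_groupI)
      fix x assume "x \<in> carrier (left_ideal_module S I)"
      thus "\<exists>y\<in>carrier (left_ideal_module S I).
          y \<oplus>\<^bsub>left_ideal_module S I\<^esub> x = \<zero>\<^bsub>left_ideal_module S I\<^esub>"
        using I.a_inv_closed sub by (auto simp: left_ideal_module_def intro!: bexI[of _ "\<ominus>\<^bsub>S\<^esub> x"] S.l_neg)
    qed (auto simp: left_ideal_module_def sub S.a_ac I.a_closed)
  qed (auto simp: left_ideal_module_def mult sub S.l_distr S.r_distr S.m_assoc)
qed


lemma module_hom_finsum:
  fixes A B
  assumes A: "abelian_group A" and B: "abelian_group B" and h: "h \<in> module_hom Q A B"
    and "finite I" "F \<in> I \<rightarrow> carrier A"
  shows "h (finsum A F I) = finsum B (\<lambda>i. h (F i)) I"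
  using assms(4,5)
proof (induction I)
  interpret A: abelian_group A by fact
  interpret B: abelian_group B by fact
  have hc: "h x \<in> carrier B" if "x \<in> carrier A" for x
    using h that by (auto simp: module_hom_def)
  have ha: "h (x \<oplus>\<^bsub>A\<^esub> y) = h x \<oplus>\<^bsub>B\<^esub> h y" if "x \<in> carrier A" "y \<in> carrier A" for x y
    using h that by (auto simp: module_hom_def)
  {
    case empty
    have "h \<zero>\<^bsub>A\<^esub> \<oplus>\<^bsub>B\<^esub> h \<zero>\<^bsub>A\<^esub> = h \<zero>\<^bsub>A\<^esub>"
      using ha[of "\<zero>\<^bsub>A\<^esub>" "\<zero>\<^bsub>A\<^esub>"] by simp
    thus ?case using hc by simp
  next
    case (insert i I)
    have "F i \<in> carrier A" "(\<lambda>i. h (F i)) \<in> I \<rightarrow> carrier B" "h (F i) \<in> carrier B"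
      using insert.prems hc by auto
    thus ?case using insert ha by (simp add: A.finsum_closed)
  }
qed

lemma kernel_module:
  fixes N L
  assumes N: "left_module S N" and L: "left_module S L" and h: "h \<in> module_hom S N L"
  defines "K \<equiv> N\<lparr>carrier := {x \<in> carrier N. h x = \<zero>\<^bsub>L\<^esub>}\<rparr>"
  shows "left_module S K"
proof -
  interpret N: left_module S N by fact
  interpret L: left_module S L by fact
  have hc: "h x \<in> carrier L" if "x \<in> carrier N" for x
    using h that by (auto simp: module_hom_def)
  have ha: "h (x \<oplus>\<^bsub>N\<^esub> y) = h x \<oplus>\<^bsub>L\<^esub> h y" if "x \<in> carrier N" "y \<in> carrier N" for x y
    using h that by (auto simp: module_hom_def)
  have hs: "h (s \<odot>\<^bsub>N\<^esub> y) = s \<odot>\<^bsub>L\<^esub> h y" if "s \<in> carrier S" "y \<in> carrier N" for s y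
    using h that by (auto simp: module_hom_def)
  have h0: "h \<zero>\<^bsub>N\<^esub> = \<zero>\<^bsub>L\<^esub>"
    using ha[of "\<zero>\<^bsub>N\<^esub>" "\<zero>\<^bsub>N\<^esub>"] hc by simp
  have s0: "s \<odot>\<^bsub>L\<^esub> \<zero>\<^bsub>L\<^esub> = \<zero>\<^bsub>L\<^esub>" if "s \<in> carrier S" for s
    using L.smult_r_distr[OF that, of "\<zero>\<^bsub>L\<^esub>" "\<zero>\<^bsub>L\<^esub>"] that by simp
  show ?thesis
    unfolding left_module_def left_module_axioms_def
  proof (intro conjI gr_ring)
    show "abelian_group K"
    proof (rule abelian_groupI)
      fix x assume "x \<in> carrier K"
      hence x: "x \<in> carrier N" "h x = \<zero>\<^bsub>L\<^esub>" by (auto simp: K_def)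
      have "h (\<ominus>\<^bsub>N\<^esub> x) = \<zero>\<^bsub>L\<^esub>"
        using ha[of "\<ominus>\<^bsub>N\<^esub> x" x] x h0 hc[of "\<ominus>\<^bsub>N\<^esub> x"] by (simp add: N.M.l_neg)
      thus "\<exists>y\<in>carrier K. y \<oplus>\<^bsub>K\<^esub> x = \<zero>\<^bsub>K\<^esub>"
        using x by (auto simp: K_def intro!: exI[of _ "\<ominus>\<^bsub>N\<^esub> x"] N.M.l_neg)
    qed (auto simp: K_def h0 ha N.M.a_ac)
  qed (auto simp: K_def hs s0 N.smult_l_distr N.smult_r_distr N.smult_assoc1)
qed

end

text \<open>The test module is the coinduced module: the \<open>R\<close>-linear maps from the group ring to \<open>C\<close>.\<close>

theorem relative_projective_on_all_types:
  fixes R :: "('a, 'r) ring_scheme" and G :: "('g, 'x) monoid_scheme"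
  assumes "cring R" "group G" "finite (carrier G)"
    and C: "left_ideal C (group_ring R G)" and rp: "relative_projective R G C"
  shows "relative_projective_on TYPE('m) TYPE('n) R G C"
proof -
  interpret group_ring_ctx R G
    using assms by (intro group_ring_ctx.intro group_ring_ctx_axioms.intro)
  define CM where "CM = left_ideal_module S C"
  interpret CM: left_module S CM
    unfolding CM_def by (rule left_ideal_left_module[OF C])
  have sub: "C \<subseteq> carrier S"
    using C additive_subgroup.a_subset by (auto simp: left_ideal_def)
  have carC: "carrier CM = C" and smC: "x \<odot>\<^bsub>CM\<^esub> c = x \<otimes>\<^bsub>S\<^esub> c" for x c
    by (simp_all add: CM_def left_ideal_module_def)
  define N0 :: "('g \<Rightarrow> 'a, ('g \<Rightarrow> 'a) \<Rightarrow> 'g \<Rightarrow> 'a) module" where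
    "N0 = \<lparr>carrier = {F \<in> carrier S \<rightarrow>\<^sub>E carrier CM.
        (\<forall>x\<in>carrier S. \<forall>y\<in>carrier S. F (x \<oplus>\<^bsub>S\<^esub> y) = F x \<oplus>\<^bsub>CM\<^esub> F y) \<and>
        (\<forall>r\<in>carrier R. \<forall>x\<in>carrier S. F (con r \<otimes>\<^bsub>S\<^esub> x) = con r \<odot>\<^bsub>CM\<^esub> F x)},
      monoid.mult = undefined, one = undefined, zero = (\<lambda>x\<in>carrier S. \<zero>\<^bsub>CM\<^esub>),
      add = (\<lambda>F H. \<lambda>x\<in>carrier S. F x \<oplus>\<^bsub>CM\<^esub> H x),
      smult = (\<lambda>a F. \<lambda>x\<in>carrier S. F (x \<otimes>\<^bsub>S\<^esub> a))\<rparr>"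
  have s0: "s \<odot>\<^bsub>CM\<^esub> \<zero>\<^bsub>CM\<^esub> = \<zero>\<^bsub>CM\<^esub>" if "s \<in> carrier S" for s
    using CM.smult_r_distr[OF that, of "\<zero>\<^bsub>CM\<^esub>" "\<zero>\<^bsub>CM\<^esub>"] that by simp
  have N0_app: "F x \<in> carrier CM" if "F \<in> carrier N0" "x \<in> carrier S" for F x
    using that by (auto simp: N0_def)
  have N0_a: "F (x \<oplus>\<^bsub>S\<^esub> y) = F x \<oplus>\<^bsub>CM\<^esub> F y"
    if "F \<in> carrier N0" "x \<in> carrier S" "y \<in> carrier S" for F x y
    using that by (auto simp: N0_def)
  have N0_r: "F (con r \<otimes>\<^bsub>S\<^esub> x) = con r \<odot>\<^bsub>CM\<^esub> F x"
    if "F \<in> carrier N0" "r \<in> carrier R" "x \<in> carrier S" for F r x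
    using that by (auto simp: N0_def)
  have N0_add: "(F \<oplus>\<^bsub>N0\<^esub> H) x = F x \<oplus>\<^bsub>CM\<^esub> H x" if "x \<in> carrier S" for F H x
    using that by (simp add: N0_def)
  have N0_zero: "\<zero>\<^bsub>N0\<^esub> x = \<zero>\<^bsub>CM\<^esub>" if "x \<in> carrier S" for x
    using that by (simp add: N0_def)
  have N0_smult: "(a \<odot>\<^bsub>N0\<^esub> F) x = F (x \<otimes>\<^bsub>S\<^esub> a)" if "x \<in> carrier S" for a F x
    using that by (simp add: N0_def)
  have N0_eqI: "F = H"
    if "F \<in> carrier N0" "H \<in> carrier N0" "\<And>x. x \<in> carrier S \<Longrightarrow> F x = H x" for F H
    using that by (auto simp: N0_def intro: PiE_ext)
  have N0_I: "F \<in> carrier N0"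
    if "F \<in> extensional (carrier S)" "\<And>x. x \<in> carrier S \<Longrightarrow> F x \<in> carrier CM"
      "\<And>x y. x \<in> carrier S \<Longrightarrow> y \<in> carrier S \<Longrightarrow> F (x \<oplus>\<^bsub>S\<^esub> y) = F x \<oplus>\<^bsub>CM\<^esub> F y"
      "\<And>r x. r \<in> carrier R \<Longrightarrow> x \<in> carrier S \<Longrightarrow> F (con r \<otimes>\<^bsub>S\<^esub> x) = con r \<odot>\<^bsub>CM\<^esub> F x" for F
    using that by (auto simp: N0_def PiE_def)
  have ext: "F \<oplus>\<^bsub>N0\<^esub> H \<in> extensional (carrier S)" "\<zero>\<^bsub>N0\<^esub> \<in> extensional (carrier S)"
      "a \<odot>\<^bsub>N0\<^esub> F \<in> extensional (carrier S)" for F H a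
    by (auto simp: N0_def)
  have N0_add_closed: "F \<oplus>\<^bsub>N0\<^esub> H \<in> carrier N0" if "F \<in> carrier N0" "H \<in> carrier N0" for F H
    using that by (intro N0_I)
      (auto simp: ext N0_add N0_app N0_a N0_r con_closed CM.smult_r_distr CM.M.a_ac)
  have N0_zero_closed: "\<zero>\<^bsub>N0\<^esub> \<in> carrier N0"
    by (intro N0_I) (auto simp: ext N0_zero con_closed s0)
  have N0_smult_closed: "a \<odot>\<^bsub>N0\<^esub> F \<in> carrier N0" if "F \<in> carrier N0" "a \<in> carrier S" for F a
    using that by (intro N0_I)
      (auto simp: ext N0_smult N0_app N0_a N0_r con_closed S.l_distr S.m_assoc)
  have N0: "left_module S N0"
    unfolding left_module_def left_module_axioms_def
  proof (intro conjI gr_ring)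
    show "abelian_group N0"
    proof (rule abelian_groupI)
      fix F assume F: "F \<in> carrier N0"
      let ?H = "\<lambda>x\<in>carrier S. \<ominus>\<^bsub>CM\<^esub> F x"
      have sneg: "s \<odot>\<^bsub>CM\<^esub> (\<ominus>\<^bsub>CM\<^esub> c) = \<ominus>\<^bsub>CM\<^esub> (s \<odot>\<^bsub>CM\<^esub> c)"
        if "s \<in> carrier S" "c \<in> carrier CM" for s c
        using CM.smult_r_distr[OF that(1), of "\<ominus>\<^bsub>CM\<^esub> c" c] that
        by (metis CM.M.a_inv_closed CM.M.l_neg CM.M.minus_equality CM.smult_closed s0)
      have "?H \<in> carrier N0"
        using F by (intro N0_I) (auto simp: N0_app N0_a N0_r con_closed CM.M.minus_add sneg)
      moreover have "?H \<oplus>\<^bsub>N0\<^esub> F = \<zero>\<^bsub>N0\<^esub>"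
        using calculation F by (intro N0_eqI)
          (auto simp: N0_add_closed N0_zero_closed N0_add N0_zero N0_app CM.M.l_neg)
      ultimately show "\<exists>H\<in>carrier N0. H \<oplus>\<^bsub>N0\<^esub> F = \<zero>\<^bsub>N0\<^esub>" by blast
    qed (auto intro!: N0_eqI simp: N0_add_closed N0_zero_closed N0_add N0_zero N0_app
          CM.M.a_ac)
  qed (auto intro!: N0_eqI simp: N0_add_closed N0_smult_closed N0_smult N0_add N0_app N0_a
        S.r_distr S.m_assoc)
  interpret N0: left_module S N0 by (rule N0)
  define T where "T F = F \<one>\<^bsub>S\<^esub>" for F :: "('g \<Rightarrow> 'a) \<Rightarrow> 'g \<Rightarrow> 'a"
  have T: "T \<in> module_hom R (restrict_scalars con N0) (restrict_scalars con CM)"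
  proof -
    have "(con r \<odot>\<^bsub>N0\<^esub> F) \<one>\<^bsub>S\<^esub> = con r \<odot>\<^bsub>CM\<^esub> F \<one>\<^bsub>S\<^esub>" if "r \<in> carrier R" "F \<in> carrier N0" for r F
      using that N0_r[of F r "\<one>\<^bsub>S\<^esub>"] by (simp add: N0_smult con_closed)
    thus ?thesis
      by (auto simp: module_hom_def restrict_scalars_def T_def N0_app N0_add)
  qed
  define \<phi>0 where "\<phi>0 = avg N0 CM T"
  have \<phi>0: "\<phi>0 \<in> module_hom S N0 CM"
    unfolding \<phi>0_def by (rule avg_hom[OF N0 CM.left_module_axioms T])
  define \<psi>0 where "\<psi>0 c = (\<lambda>x\<in>carrier S. con (x \<one>\<^bsub>G\<^esub>) \<odot>\<^bsub>CM\<^esub> c)" for c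
  have con_add: "con (r \<oplus>\<^bsub>R\<^esub> s) = con r \<oplus>\<^bsub>S\<^esub> con s" if "r \<in> carrier R" "s \<in> carrier R" for r s
    using that by (intro gr_eqI) (auto simp: con_closed gr_add, auto simp: gr_const_def)
  have con_mul: "con (r \<otimes>\<^bsub>R\<^esub> s) = con r \<otimes>\<^bsub>S\<^esub> con s" if "r \<in> carrier R" "s \<in> carrier R" for r s
    using that by (intro gr_eqI) (auto simp: con_closed con_mult, auto simp: gr_const_def)
  have x1: "x \<one>\<^bsub>G\<^esub> \<in> carrier R" if "x \<in> carrier S" for x
    using that gr_closed by simp
  have \<psi>0c: "\<psi>0 c \<in> carrier N0" if c: "c \<in> carrier CM" for c
    unfolding \<psi>0_def using c
    by (intro N0_I)
      (auto simp: con_closed x1 gr_add con_add CM.smult_l_distr con_mult con_mul CM.smult_assoc1)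
  have \<psi>0: "\<psi>0 \<in> module_hom R (restrict_scalars con CM) (restrict_scalars con N0)"
  proof -
    have "\<psi>0 (c \<oplus>\<^bsub>CM\<^esub> d) = \<psi>0 c \<oplus>\<^bsub>N0\<^esub> \<psi>0 d" if "c \<in> carrier CM" "d \<in> carrier CM" for c d
      using that by (intro N0_eqI)
        (auto simp: N0_add_closed \<psi>0c N0_add, auto simp: \<psi>0_def con_closed x1 CM.smult_r_distr)
    moreover have "\<psi>0 (con r \<odot>\<^bsub>CM\<^esub> c) = con r \<odot>\<^bsub>N0\<^esub> \<psi>0 c"
      if "r \<in> carrier R" "c \<in> carrier CM" for r c
      using that
      by (intro N0_eqI)
        (auto simp: N0_smult_closed con_closed \<psi>0c N0_smult,
         auto simp: \<psi>0_def con_closed x1 mult_con con_mul simp flip: CM.smult_assoc1)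
    ultimately show ?thesis
      using \<psi>0c by (auto simp: module_hom_def restrict_scalars_def)
  qed
  have \<phi>\<psi>0: "\<phi>0 (\<psi>0 c) = c" if c: "c \<in> carrier CM" for c
  proof -
    have z: "con \<zero>\<^bsub>R\<^esub> \<odot>\<^bsub>CM\<^esub> c = \<zero>\<^bsub>CM\<^esub>"
      using c CM.smult_l_distr[of "con \<zero>\<^bsub>R\<^esub>" "con \<zero>\<^bsub>R\<^esub>" c] con_add[of "\<zero>\<^bsub>R\<^esub>" "\<zero>\<^bsub>R\<^esub>"]
      by (simp add: con_closed)
    have "\<phi>0 (\<psi>0 c) = (\<Oplus>\<^bsub>CM\<^esub>g\<in>carrier G. if \<one>\<^bsub>G\<^esub> = g then c else \<zero>\<^bsub>CM\<^esub>)"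
      unfolding \<phi>0_def avg_def
    proof (intro CM.M.finsum_cong')
      fix g assume g: "g \<in> carrier G"
      have "T (bas g \<odot>\<^bsub>N0\<^esub> \<psi>0 c) = con (bas g \<one>\<^bsub>G\<^esub>) \<odot>\<^bsub>CM\<^esub> c"
        using g by (simp add: T_def N0_smult bas_closed \<psi>0_def)
      also have "bas g \<one>\<^bsub>G\<^esub> = (if \<one>\<^bsub>G\<^esub> = g then \<one>\<^bsub>R\<^esub> else \<zero>\<^bsub>R\<^esub>)"
        by (simp add: bas_def)
      finally show "bas (inv\<^bsub>G\<^esub> g) \<odot>\<^bsub>CM\<^esub> T (bas g \<odot>\<^bsub>N0\<^esub> \<psi>0 c) = (if \<one>\<^bsub>G\<^esub> = g then c else \<zero>\<^bsub>CM\<^esub>)"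
        using c g by (auto simp: con_one z s0 bas_closed simp flip: gr_one)
    qed (use c in auto)
    also have "\<dots> = c"
      using c by (subst CM.M.finsum_singleton[of _ _ "\<lambda>_. c"]) (auto simp: fin)
    finally show ?thesis .
  qed
  define M0 where "M0 = N0\<lparr>carrier := {F \<in> carrier N0. \<phi>0 F = \<zero>\<^bsub>CM\<^esub>}\<rparr>"
  have M0: "left_module S M0"
    unfolding M0_def by (rule kernel_module[OF N0 CM.left_module_axioms \<phi>0])
  have \<phi>0c: "\<phi>0 F \<in> carrier CM" if "F \<in> carrier N0" for F
    using \<phi>0 that by (auto simp: module_hom_def)
  have "short_exact S M0 (\<lambda>x. x) N0 \<phi>0 CM"
    unfolding short_exact_def
  proof (intro conjI M0 N0 CM.left_module_axioms \<phi>0)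
    show "\<phi>0 ` carrier N0 = carrier CM"
      using \<phi>0c \<phi>\<psi>0 \<psi>0c by (metis (no_types, lifting) image_subset_iff subsetI subset_antisym imageI)
  qed (auto simp: module_hom_def M0_def)
  moreover have "has_section R (restrict_scalars con N0) \<phi>0 (restrict_scalars con CM)"
    using \<psi>0 \<phi>\<psi>0 by (auto simp: has_section_def restrict_scalars_def)
  ultimately have "has_section S N0 \<phi>0 CM"
    using rp unfolding relative_projective_def relative_projective_on_def Let_def
    by (fold CM_def) blast
  then obtain \<eta> where \<eta>: "\<eta> \<in> module_hom S CM N0" and \<phi>\<eta>: "\<And>c. c \<in> carrier CM \<Longrightarrow> \<phi>0 (\<eta> c) = c"
    by (auto simp: has_section_def)
  have \<eta>c: "\<eta> c \<in> carrier N0" if "c \<in> carrier CM" for c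
    using \<eta> that by (auto simp: module_hom_def)
  have \<eta>s: "\<eta> (s \<odot>\<^bsub>CM\<^esub> c) = s \<odot>\<^bsub>N0\<^esub> \<eta> c" if "s \<in> carrier S" "c \<in> carrier CM" for s c
    using \<eta> that by (auto simp: module_hom_def)
  define \<theta> where "\<theta> c = T (\<eta> c)" for c
  have \<theta>: "\<theta> \<in> module_hom R (restrict_scalars con CM) (restrict_scalars con CM)"
    using \<eta> T by (auto simp: module_hom_def restrict_scalars_def \<theta>_def con_closed Pi_iff)
  have \<theta>_avg: "avg CM CM \<theta> c = c" if c: "c \<in> carrier CM" for c
  proof -
    have "avg CM CM \<theta> c = \<phi>0 (\<eta> c)"
      unfolding \<phi>0_def avg_def \<theta>_def using c T \<eta>c
      by (intro CM.M.finsum_cong')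
        (auto simp: \<eta>s bas_closed Pi_iff module_hom_def restrict_scalars_def
          intro!: CM.smult_closed N0.smult_closed)
    thus ?thesis using \<phi>\<eta>[OF c] by simp
  qed
  show ?thesis
    unfolding relative_projective_on_def Let_def
  proof (intro allI impI, fold CM_def)
    fix M :: "('g \<Rightarrow> 'a, 'm) module" and N :: "('g \<Rightarrow> 'a, 'n) module" and f \<phi>
    assume ex: "short_exact S M f N \<phi> CM"
      and sec: "has_section R (restrict_scalars con N) \<phi> (restrict_scalars con CM)"
    have N: "left_module S N" and \<phi>: "\<phi> \<in> module_hom S N CM"
      using ex by (auto simp: short_exact_def)
    interpret N: left_module S N by (rule N)
    obtain \<psi> where \<psi>: "\<psi> \<in> module_hom R (restrict_scalars con CM) (restrict_scalars con N)"
      and \<phi>\<psi>: "\<And>c. c \<in> carrier CM \<Longrightarrow> \<phi> (\<psi> c) = c"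
      using sec by (auto simp: has_section_def restrict_scalars_def)
    have \<psi>\<theta>: "(\<lambda>c. \<psi> (\<theta> c)) \<in> module_hom R (restrict_scalars con CM) (restrict_scalars con N)"
      using \<psi> \<theta> by (auto simp: module_hom_def restrict_scalars_def Pi_iff)
    have cl: "\<theta> c \<in> carrier CM" "\<psi> c \<in> carrier N" if "c \<in> carrier CM" for c
      using \<psi> \<theta> that by (auto simp: module_hom_def restrict_scalars_def Pi_iff)
    have "\<phi> (avg CM N (\<lambda>c. \<psi> (\<theta> c)) c) = c" if c: "c \<in> carrier CM" for c
    proof -
      have "\<phi> (avg CM N (\<lambda>c. \<psi> (\<theta> c)) c) =
          (\<Oplus>\<^bsub>CM\<^esub>g\<in>carrier G. \<phi> (bas (inv\<^bsub>G\<^esub> g) \<odot>\<^bsub>N\<^esub> \<psi> (\<theta> (bas g \<odot>\<^bsub>CM\<^esub> c))))"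
        unfolding avg_def using c
        by (intro module_hom_finsum[OF N.M.abelian_group_axioms CM.M.abelian_group_axioms \<phi> fin])
          (auto intro!: N.smult_closed CM.smult_closed cl bas_closed)
      also have "\<dots> = avg CM CM \<theta> c"
        unfolding avg_def
      proof (intro CM.M.finsum_cong')
        fix g assume g: "g \<in> carrier G"
        have "\<theta> (bas g \<odot>\<^bsub>CM\<^esub> c) \<in> carrier CM"
          using c g by (intro cl CM.smult_closed bas_closed)
        thus "\<phi> (bas (inv\<^bsub>G\<^esub> g) \<odot>\<^bsub>N\<^esub> \<psi> (\<theta> (bas g \<odot>\<^bsub>CM\<^esub> c))) = bas (inv\<^bsub>G\<^esub> g) \<odot>\<^bsub>CM\<^esub> \<theta> (bas g \<odot>\<^bsub>CM\<^esub> c)"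
          using \<phi> cl \<phi>\<psi> bas_closed by (auto simp: module_hom_def)
      qed (use c in \<open>auto intro!: CM.smult_closed cl bas_closed\<close>)
      finally show ?thesis using \<theta>_avg[OF c] by simp
    qed
    thus "has_section S N \<phi> CM"
      unfolding has_section_def
      using avg_hom[OF CM.left_module_axioms N \<psi>\<theta>] by blast
  qed
qed


section \<open>Codes over \<open>\<int>/n\<int>\<close>\<close>

text \<open>Elements of \<open>residue_ring n\<close> are the integers \<open>0, \<dots>, n - 1\<close>. So reduction modulo the
  maximal ideal, from \<open>\<int>/p\<^sup>l\<int>\<close> to \<open>\<int>/p\<int>\<close>, is the remainder modulo \<open>p\<close>.\<close>

definition zn_group_ring :: "int \<Rightarrow> ('g, 'x) monoid_scheme \<Rightarrow> ('g \<Rightarrow> int) ring" where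
  "zn_group_ring n G = group_ring (residue_ring n) G"

definition int_scale :: "int \<Rightarrow> ('g, 'x) monoid_scheme \<Rightarrow> int \<Rightarrow> ('g \<Rightarrow> int) \<Rightarrow> ('g \<Rightarrow> int)" where
  "int_scale n G k a = (\<lambda>g\<in>carrier G. k * a g mod n)"

definition reduce_mod :: "int \<Rightarrow> ('g, 'x) monoid_scheme \<Rightarrow> ('g \<Rightarrow> int) \<Rightarrow> ('g \<Rightarrow> int)" where
  "reduce_mod n G a = (\<lambda>g\<in>carrier G. a g mod n)"

text \<open>\<open>\<mm>\<^sup>jRG\<close> for \<open>R = \<int>/p\<^sup>l\<int>\<close>; as \<open>\<mm>\<^sup>j = p\<^sup>jR\<close>, it consists of the multiples \<open>p\<^sup>j r\<close>.\<close>

definition max_ideal_pow_gr :: "nat \<Rightarrow> nat \<Rightarrow> ('g, 'x) monoid_scheme \<Rightarrow> nat \<Rightarrow> ('g \<Rightarrow> int) set" where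
  "max_ideal_pow_gr p l G j =
     int_scale (int p ^ l) G (int p ^ j) ` carrier (zn_group_ring (int p ^ l) G)"

definition layer_quot ::
  "nat \<Rightarrow> nat \<Rightarrow> ('g, 'x) monoid_scheme \<Rightarrow> nat \<Rightarrow> ('g \<Rightarrow> int) \<Rightarrow> ('g \<Rightarrow> int) set"
where
  "layer_quot p l G j c = max_ideal_pow_gr p l G (Suc j) +>\<^bsub>zn_group_ring (int p ^ l) G\<^esub> c"

text \<open>The map \<open>\<alpha>\<^sub>j\<close> sends the coset of \<open>p\<^sup>j r\<close> to the reduction of \<open>r\<close>; it is well defined
  by \<open>layer_map_coset\<close>.\<close>

definition layer_map ::
  "nat \<Rightarrow> nat \<Rightarrow> ('g, 'x) monoid_scheme \<Rightarrow> nat \<Rightarrow> ('g \<Rightarrow> int) set \<Rightarrow> ('g \<Rightarrow> int)"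
where
  "layer_map p l G j X = (THE a. \<exists>r\<in>carrier (zn_group_ring (int p ^ l) G).
     int_scale (int p ^ l) G (int p ^ j) r \<in> X \<and> a = reduce_mod (int p) G r)"

text \<open>Inside \<open>\<mm>\<^sup>jRG / \<mm>\<^sup>j\<^sup>+\<^sup>1RG\<close>, the quotient of the intersections of \<open>C\<close> consists of the
  cosets of the elements of \<open>C \<inter> \<mm>\<^sup>jRG\<close>.\<close>

definition chain_code ::
  "nat \<Rightarrow> nat \<Rightarrow> ('g, 'x) monoid_scheme \<Rightarrow> ('g \<Rightarrow> int) set \<Rightarrow> nat \<Rightarrow> ('g \<Rightarrow> int) set"
where
  "chain_code p l G C j =
     layer_map p l G j ` layer_quot p l G j ` (C \<inter> max_ideal_pow_gr p l G j)"

definition euclid_weight :: "int \<Rightarrow> ('g, 'x) monoid_scheme \<Rightarrow> ('g \<Rightarrow> int) \<Rightarrow> nat" where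
  "euclid_weight n G c = (LEAST w. \<exists>a :: 'g \<Rightarrow> int.
     (\<forall>g\<in>carrier G. [a g = c g] (mod n)) \<and> int w = (\<Sum>g\<in>carrier G. (a g)\<^sup>2))"

text \<open>As the weights are natural numbers, the infimum is a minimum if \<open>C \<noteq> {0}\<close>, and \<open>\<infinity>\<close>
  otherwise.\<close>

definition euclid_min_weight :: "int \<Rightarrow> ('g, 'x) monoid_scheme \<Rightarrow> ('g \<Rightarrow> int) set \<Rightarrow> ereal" where
  "euclid_min_weight n G C =
     (INF c\<in>C - {\<zero>\<^bsub>zn_group_ring n G\<^esub>}. ereal (real (euclid_weight n G c)))"

lemma layer_map_coset:
  assumes "p > 1" "j < l" "r \<in> carrier (zn_group_ring (int p ^ l) G)"
  shows "layer_map p l G j (layer_quot p l G j (int_scale (int p ^ l) G (int p ^ j) r)) =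
    reduce_mod (int p) G r"
proof -
  let ?n = "int p ^ l"
  let ?S = "zn_group_ring ?n G"
  let ?X = "layer_quot p l G j (int_scale ?n G (int p ^ j) r)"
  have "?n > 1" using assms by simp
  have split: "?n = int p ^ j * (int p * int p ^ (l - Suc j))"
    using assms(2) by (simp flip: power_Suc power_add)
  have zero: "(\<lambda>g\<in>carrier G. 0) \<in> carrier ?S"
    using \<open>?n > 1\<close> assms(1) by (auto simp: zn_group_ring_def group_ring_def residue_ring_def)
  have mem: "int_scale ?n G (int p ^ j) r \<in> ?X"
  proof -
    have "int_scale ?n G (int p ^ j) r =
        int_scale ?n G (int p ^ Suc j) (\<lambda>g\<in>carrier G. 0) \<oplus>\<^bsub>?S\<^esub> int_scale ?n G (int p ^ j) r"
      using assms(1)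
      by (auto simp: int_scale_def zn_group_ring_def group_ring_def residue_ring_def fun_eq_iff)
    thus ?thesis
      using zero by (auto simp: layer_quot_def a_r_coset_def' max_ideal_pow_gr_def)
  qed
  have uniq: "reduce_mod (int p) G r' = reduce_mod (int p) G r"
    if r': "int_scale ?n G (int p ^ j) r' \<in> ?X" for r'
  proof -
    obtain s where s: "int_scale ?n G (int p ^ j) r' =
        int_scale ?n G (int p ^ Suc j) s \<oplus>\<^bsub>?S\<^esub> int_scale ?n G (int p ^ j) r"
      using r' by (auto simp: layer_quot_def a_r_coset_def' max_ideal_pow_gr_def)
    have "r' g mod int p = r g mod int p" if g: "g \<in> carrier G" for g
    proof -
      have "int p ^ j * r' g mod ?n = (int p ^ Suc j * s g + int p ^ j * r g) mod ?n"
        using fun_cong[OF s, of g] g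
        by (simp add: int_scale_def zn_group_ring_def group_ring_def residue_ring_def mod_add_eq)
      hence "?n dvd int p ^ j * r' g - (int p ^ Suc j * s g + int p ^ j * r g)"
        by (simp add: mod_eq_dvd_iff)
      also have "int p ^ j * r' g - (int p ^ Suc j * s g + int p ^ j * r g) =
          int p ^ j * (r' g - r g - int p * s g)"
        by (simp add: algebra_simps)
      finally have "int p dvd r' g - r g - int p * s g"
        using assms(1) unfolding split by (auto dest: dvd_mult_left)
      hence "int p dvd r' g - r g" by (metis dvd_add dvd_triv_left diff_add_cancel)
      thus ?thesis by (simp add: mod_eq_dvd_iff)
    qed
    thus ?thesis by (auto simp: reduce_mod_def fun_eq_iff)
  qed
  show ?thesis
    unfolding layer_map_def using mem uniq assms(3) by (intro the_equality) blast+
qed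

end

(* If p^j is the largest power of p dividing a nonzero codeword c, then c = p^j r, and r mod p is a
   nonzero word of C_j. Every integer lift of c is p^j b with b a lift of r mod p, so
   w_E(c) >= p^(2j) w_E(r mod p) >= p^(2j) d_E(C_j) >= gamma. *)
theory Submission
  imports Defs
begin

lemma carrier_zn_group_ring:
  "carrier (zn_group_ring n G) = carrier G \<rightarrow>\<^sub>E {0..n - 1}"
  by (simp add: zn_group_ring_def group_ring_def residue_ring_def)

lemma zero_zn_group_ring: "\<zero>\<^bsub>zn_group_ring n G\<^esub> = (\<lambda>g\<in>carrier G. 0)"
  by (simp add: zn_group_ring_def group_ring_def residue_ring_def)

lemma euclid_weight_attained:
  obtains a where "\<And>g. g \<in> carrier G \<Longrightarrow> [a g = c g] (mod n)"
    and "int (euclid_weight n G c) = (\<Sum>g\<in>carrier G. (a g)\<^sup>2)"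
proof -
  let ?P = "\<lambda>w. \<exists>a. (\<forall>g\<in>carrier G. [a g = c g] (mod n)) \<and> int w = (\<Sum>g\<in>carrier G. (a g)\<^sup>2)"
  \<comment> \<open>The word \<open>c\<close> is an integer lift of itself, so some weight satisfies
    \<open>?P\<close> and the \<open>LEAST\<close> is attained.\<close>
  have "?P (nat (\<Sum>g\<in>carrier G. (c g)\<^sup>2))"
    by (intro exI[of _ c]) (simp add: sum_nonneg)
  hence "?P (LEAST w. ?P w)" by (rule LeastI)
  thus thesis using that unfolding euclid_weight_def by blast
qed

lemma euclid_weight_le:
  assumes "\<And>g. g \<in> carrier G \<Longrightarrow> [a g = c g] (mod n)"
  shows "int (euclid_weight n G c) \<le> (\<Sum>g\<in>carrier G. (a g)\<^sup>2)"
proof -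
  have "euclid_weight n G c \<le> nat (\<Sum>g\<in>carrier G. (a g)\<^sup>2)"
    unfolding euclid_weight_def using assms
    by (intro Least_le exI[of _ a]) (simp add: sum_nonneg)
  thus ?thesis by (simp add: sum_nonneg le_nat_iff)
qed

text \<open>Since \<open>k * m\<close> divides \<open>n\<close>, a lift of \<open>k * r\<close>
  modulo \<open>n\<close> is still one modulo \<open>k * m\<close>. It is therefore \<open>k\<close>
  times a lift of \<open>r\<close> modulo \<open>m\<close>, and pulling \<open>k\<close> out of the
  squares gives the factor \<open>k\<^sup>2\<close>.\<close>

lemma euclid_weight_int_scale:
  assumes "m dvd n" "k * m dvd n" "k \<noteq> 0"
  shows "k\<^sup>2 * int (euclid_weight m G (reduce_mod m G r)) \<le>
    int (euclid_weight n G (int_scale n G k r))"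
proof -
  obtain a where a: "\<And>g. g \<in> carrier G \<Longrightarrow> [a g = int_scale n G k r g] (mod n)"
    and w: "int (euclid_weight n G (int_scale n G k r)) = (\<Sum>g\<in>carrier G. (a g)\<^sup>2)"
    using euclid_weight_attained[where G = G and n = n and c = "int_scale n G k r"] by blast
  have km: "k * m dvd a g - k * r g" if "g \<in> carrier G" for g
    using a[OF that] that assms(2)
    by (auto simp: int_scale_def cong_def mod_eq_dvd_iff intro: dvd_trans)
  have ka: "k dvd a g" if "g \<in> carrier G" for g
    using dvd_mult_left[OF km[OF that]] by (simp add: dvd_diff_left_iff)
  \<comment> \<open>From the optimal lift \<open>a\<close> of the scaled word; \<open>b\<close> need
    not be optimal for the reduced word, but an upper bound for its weight suffices.\<close>
  define b where "b g = a g div k" for g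
  have ab: "a g = k * b g" if "g \<in> carrier G" for g
    using ka[OF that] by (simp add: b_def)
  have "[b g = reduce_mod m G r g] (mod m)" if g: "g \<in> carrier G" for g
  proof -
    have "k * m dvd k * (b g - r g)" using km[OF g] ab[OF g] by (simp add: algebra_simps)
    thus ?thesis using assms(3) g by (simp add: reduce_mod_def cong_def mod_eq_dvd_iff)
  qed
  hence "int (euclid_weight m G (reduce_mod m G r)) \<le> (\<Sum>g\<in>carrier G. (b g)\<^sup>2)"
    by (rule euclid_weight_le)
  hence "k\<^sup>2 * int (euclid_weight m G (reduce_mod m G r)) \<le> k\<^sup>2 * (\<Sum>g\<in>carrier G. (b g)\<^sup>2)"
    by (intro mult_left_mono) auto
  also have "\<dots> = (\<Sum>g\<in>carrier G. (a g)\<^sup>2)"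
    by (simp add: sum_distrib_left ab power_mult_distrib)
  finally show ?thesis using w by simp
qed

text \<open>The exponent \<open>j\<close> is the largest with \<open>int p ^ j\<close> dividing all
  coefficients of \<open>c\<close>. Maximality leaves a coefficient of the quotient \<open>r\<close>
  that is prime to the next factor \<open>p\<close>, so \<open>r\<close> survives reduction.\<close>

lemma nonzero_eq_int_scale:
  assumes p: "p > 1" and c: "c \<in> carrier (zn_group_ring (int p ^ l) G)"
    and nz: "c \<noteq> \<zero>\<^bsub>zn_group_ring (int p ^ l) G\<^esub>"
  obtains j r where "j < l" "r \<in> carrier (zn_group_ring (int p ^ l) G)"
    "c = int_scale (int p ^ l) G (int p ^ j) r"
    "reduce_mod (int p) G r \<noteq> \<zero>\<^bsub>zn_group_ring (int p) G\<^esub>"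
proof -
  let ?P = "\<lambda>j. \<forall>g\<in>carrier G. int p ^ j dvd c g"
  have cb: "0 \<le> c g" "c g < int p ^ l" if "g \<in> carrier G" for g
    using c that by (auto simp: carrier_zn_group_ring)
  obtain g0 where g0: "g0 \<in> carrier G" "c g0 \<noteq> 0"
  proof (rule ccontr)
    assume "\<not> thesis"
    hence "\<And>g. g \<in> carrier G \<Longrightarrow> c g = 0" using that by blast
    hence "c = (\<lambda>g\<in>carrier G. 0)"
      using c by (auto simp: carrier_zn_group_ring fun_eq_iff PiE_def extensional_def)
    thus False using nz by (simp add: zero_zn_group_ring)
  qed
  \<comment> \<open>The representative \<open>c g0\<close> lies strictly between 0 and
    \<open>int p ^ l\<close>, so \<open>int p ^ l\<close> cannot divide it. This bounds the
    exponents, and as \<open>?P 0\<close> is trivial, the \<open>GREATEST\<close> below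
    exists.\<close>
  have less: "j < l" if "?P j" for j
  proof (rule ccontr)
    assume "\<not> j < l"
    hence "int p ^ l dvd c g0" using that g0(1) by (meson le_imp_power_dvd dvd_trans not_less)
    hence "int p ^ l \<le> c g0" using cb(1)[OF g0(1)] g0(2) by (intro zdvd_imp_le) auto
    thus False using cb(2)[OF g0(1)] by simp
  qed
  define j where "j = (GREATEST j. ?P j)"
  have Pj: "?P j"
    unfolding j_def by (rule GreatestI_nat[of ?P 0 l]) (use less in \<open>auto intro: less_imp_le\<close>)
  have "\<not> ?P (Suc j)"
    using Greatest_le_nat[of ?P "Suc j" l] less unfolding j_def[symmetric]
    by (meson less_imp_le Suc_n_not_le_n)
  then obtain g1 where g1: "g1 \<in> carrier G" "\<not> int p ^ Suc j dvd c g1" by blast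
  define r where "r = (\<lambda>g\<in>carrier G. c g div int p ^ j)"
  have cr: "c g = int p ^ j * r g" if "g \<in> carrier G" for g
    using Pj that by (simp add: r_def)
  show thesis
  proof (rule that)
    show "j < l" using less Pj by blast
    \<comment> \<open>Dividing by \<open>int p ^ j\<close>, which is at least 1, only shrinks a
      nonnegative representative, so \<open>r\<close> needs no reduction modulo
      \<open>int p ^ l\<close>.\<close>
    have "0 \<le> c g div int p ^ j \<and> c g div int p ^ j \<le> int p ^ l - 1" if "g \<in> carrier G" for g
    proof -
      have "1 \<le> int p ^ j" using p by simp
      hence "c g div int p ^ j \<le> c g div 1" using cb[OF that] by (intro zdiv_mono2) auto
      thus ?thesis using cb[OF that] p by (simp add: pos_imp_zdiv_nonneg_iff)
    qed
    thus "r \<in> carrier (zn_group_ring (int p ^ l) G)"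
      by (auto simp: carrier_zn_group_ring r_def)
    show "c = int_scale (int p ^ l) G (int p ^ j) r"
    proof
      fix g
      show "c g = int_scale (int p ^ l) G (int p ^ j) r g"
      proof (cases "g \<in> carrier G")
        case True
        have "int_scale (int p ^ l) G (int p ^ j) r g = c g mod int p ^ l"
          unfolding cr[OF True] int_scale_def using True by (rule restrict_apply')
        thus ?thesis using cb[OF True] by simp
      next
        case False
        thus ?thesis
          using c by (simp add: int_scale_def carrier_zn_group_ring PiE_def extensional_def)
      qed
    qed
    \<comment> \<open>Otherwise \<open>int p ^ Suc j\<close> would divide
      \<open>c g1\<close>.\<close>
    have "\<not> int p dvd r g1"
      using g1(2) mult_dvd_mono[OF dvd_refl, of "int p" "r g1" "int p ^ j"]
      unfolding cr[OF g1(1)] power_Suc2 by blast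
    thus "reduce_mod (int p) G r \<noteq> \<zero>\<^bsub>zn_group_ring (int p) G\<^esub>"
      using g1(1) by (auto simp: reduce_mod_def zero_zn_group_ring fun_eq_iff dvd_eq_mod_eq_0)
  qed
qed

text \<open>By \<open>layer_map_coset\<close>, the reduction of \<open>r\<close> is the value of
  \<open>layer_map\<close> at the coset of the scaled word, which lies both in \<open>C\<close> and
  in the required power of the ideal.\<close>

lemma reduce_mod_in_chain_code:
  assumes "p > 1" "j < l" "r \<in> carrier (zn_group_ring (int p ^ l) G)"
    and "int_scale (int p ^ l) G (int p ^ j) r \<in> C"
  shows "reduce_mod (int p) G r \<in> chain_code p l G C j"
  unfolding chain_code_def layer_map_coset[OF assms(1-3), symmetric]
  using assms(3,4) by (auto simp: max_ideal_pow_gr_def)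

theorem theorem2p12:
  fixes p l :: nat and G :: "('g, 'x) monoid_scheme" and C :: "('g \<Rightarrow> int) set" and \<gamma> :: real
  assumes "prime p" and "l \<ge> 1"
    and "group G" and "finite (carrier G)"
    and "left_ideal C (zn_group_ring (int p ^ l) G)"
    and "relative_projective (residue_ring (int p ^ l)) G C"
    and "\<gamma> > 0"
    and "\<And>j. j < l \<Longrightarrow>
      euclid_min_weight (int p) G (chain_code p l G C j) \<ge> ereal (\<gamma> / real p ^ (2 * j))"
  shows "euclid_min_weight (int p ^ l) G C \<ge> ereal \<gamma>"
  unfolding euclid_min_weight_def
\<comment> \<open>It suffices to bound the weight of each nonzero word; for the zero code there is
  none, and the infimum is infinite.\<close>
proof (rule INF_greatest)
  let ?n = "int p ^ l"
  fix c assume c: "c \<in> C - {\<zero>\<^bsub>zn_group_ring ?n G\<^esub>}"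
  have p: "p > 1" using assms(1) by (rule prime_gt_1_nat)
  have "C \<subseteq> carrier (zn_group_ring ?n G)"
    using assms(5) by (auto simp: left_ideal_def dest: additive_subgroup.a_subset)
  with c have "c \<in> carrier (zn_group_ring ?n G)" "c \<noteq> \<zero>\<^bsub>zn_group_ring ?n G\<^esub>" by auto
  then obtain j r where j: "j < l" and r: "r \<in> carrier (zn_group_ring ?n G)"
    and cr: "c = int_scale ?n G (int p ^ j) r"
    and nz: "reduce_mod (int p) G r \<noteq> \<zero>\<^bsub>zn_group_ring (int p) G\<^esub>"
    by (rule nonzero_eq_int_scale[OF p])
  let ?w = "euclid_weight (int p) G (reduce_mod (int p) G r)"
  have "reduce_mod (int p) G r \<in> chain_code p l G C j"
    using c cr by (intro reduce_mod_in_chain_code[OF p j r]) auto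
  \<comment> \<open>The infimum runs over nonzero words only, hence the need for
    \<open>nz\<close>.\<close>
  with nz have "euclid_min_weight (int p) G (chain_code p l G C j) \<le> ereal (real ?w)"
    unfolding euclid_min_weight_def by (intro INF_lower) auto
  from order_trans[OF assms(8)[OF j] this] have "\<gamma> / real p ^ (2 * j) \<le> real ?w" by simp
  hence "\<gamma> \<le> real p ^ (2 * j) * real ?w"
    using p by (simp add: divide_le_eq mult.commute)
  also have "\<dots> = of_int ((int p ^ j)\<^sup>2 * int ?w)"
    by (simp add: power_mult mult.commute[of 2])
  also have "\<dots> \<le> real_of_int (int (euclid_weight ?n G c))"
    unfolding cr of_int_le_iff
  proof (rule euclid_weight_int_scale)
    show "int p dvd ?n" using assms(2) by (intro dvd_power) auto
    \<comment> \<open>With scaling factor \<open>int p ^ j\<close> and modulus \<open>int p\<close>,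
      the divisibility condition amounts to \<open>j < l\<close>.\<close>
    have "int p ^ Suc j dvd ?n" using j by (intro le_imp_power_dvd) simp
    thus "int p ^ j * int p dvd ?n" by (simp add: mult.commute)
  qed (use p in auto)
  finally show "ereal \<gamma> \<le> ereal (real (euclid_weight ?n G c))" by simp
qed

end
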